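(* Let $d,m,n$ be positive integers, let $A=\{(i,j)\in\mathbb{Z}^2: 0\le i<m,\ 0\le j<n\}$, and let $D=\{(a_h,b_h): h=1,\dots,d\}$ be a set of $d$ distinct pairs of coprime integers with $a_h\ge 0$, and $b_h=1$ whenever $a_h=0$. Let $f:A\to\mathbb{R}$ be an unknown function with line sums $$\ell_{h,t}=\sum_{(i,j)\in A,\ b_h i-a_h j=t} f(i,j)\qquad (h=1,\dots,d,\ t\in\mathbb{Z}).$$ Suppose that for every $h=1,\dots,d$ and every $t\in\mathbb{Z}$ a measured value $\ell^*_{h,t}$ of $\ell_{h,t}$ is given, and that the total number of pairs $(h,t)$ with $\ell^*_{h,t}\neq \ell_{h,t}$ (wrong line sums) is less than $d/2$. Then the correct line sums $\ell_{h,t}$ (for all $h=1,\dots,d$, $t\in\mathbb{Z}$) can be determined from the measured values $\ell^*_{h,t}$ and the set $D$.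
   Context: A pair $(h,t)$ with $\ell^*_{h,t}=\ell_{h,t}$ is called a correct line sum, otherwise a wrong line sum. "Can be determined" means the correct line sums are uniquely determined by (and computable from) the measured data under the stated bound on the number of wrong line sums. *)

theory Defs
  imports Complex_Main
begin

definition grid :: "nat \<Rightarrow> nat \<Rightarrow> (int \<times> int) set" where
  "grid m n = {(i, j). 0 \<le> i \<and> i < int m \<and> 0 \<le> j \<and> j < int n}"

text \<open>Only the values of \<open>f\<close> on the grid enter, so a function on the grid is represented by an
  arbitrary total function.\<close>

definition line_sum ::
  "nat \<Rightarrow> nat \<Rightarrow> (nat \<Rightarrow> int) \<Rightarrow> (nat \<Rightarrow> int) \<Rightarrow> (int \<times> int \<Rightarrow> real) \<Rightarrow> nat \<Rightarrow> int \<Rightarrow> real" where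
  "line_sum m n a b f h t = (\<Sum>(i, j) \<in> {(i, j) \<in> grid m n. b h * i - a h * j = t}. f (i, j))"

definition wrong_line_sums ::
  "nat \<Rightarrow> (nat \<Rightarrow> int \<Rightarrow> real) \<Rightarrow> (nat \<Rightarrow> int \<Rightarrow> real) \<Rightarrow> (nat \<times> int) set" where
  "wrong_line_sums d l lstar = {(h, t). h \<in> {1..d} \<and> lstar h t \<noteq> l h t}"

text \<open>Finite programs in exact real arithmetic (algebraic computation trees): the inputs are the
  measured values, the only constants are rational, and branching is on the sign of a previously
  computed value. Each program reads only finitely many measured values and always halts.\<close>

datatype real_program =
    Measured nat int
  | Const rat
  | Add real_program real_program
  | Sub real_program real_program
  | Mult real_program real_program
  | Div real_program real_program
  | If_nonpos real_program real_program real_program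

primrec run :: "real_program \<Rightarrow> (nat \<Rightarrow> int \<Rightarrow> real) \<Rightarrow> real" where
  "run (Measured h t) lstar = lstar h t"
| "run (Const q) lstar = of_rat q"
| "run (Add p q) lstar = run p lstar + run q lstar"
| "run (Sub p q) lstar = run p lstar - run q lstar"
| "run (Mult p q) lstar = run p lstar * run q lstar"
| "run (Div p q) lstar = run p lstar / run q lstar"
| "run (If_nonpos c p q) lstar = (if run c lstar \<le> 0 then run p lstar else run q lstar)"

end

theory Submission
  imports Defs "HOL-Computational_Algebra.Polynomial"
begin

text \<open>
  Let \<open>g\<close> be the difference of two candidate functions, extended by zero; it has fewer than \<open>d\<close>
  nonzero line sums. Suppose that the line sums of \<open>g\<close> vanish in all directions of a set \<open>Z\<close>. For
  \<open>p < card Z\<close> the sum of \<open>g (i, j) (u i + v j)^p\<close> is a binary form of degree \<open>p\<close> in \<open>(u, v)\<close> with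
  \<open>card Z\<close> non-proportional zeros, so it is zero. Hence the sequence of line sums in any other
  direction is orthogonal to all polynomials of degree less than \<open>card Z\<close>, and if it is nonzero then
  it has at least \<open>card Z + 1\<close> nonzero terms. If \<open>k \<ge> 1\<close> directions had a nonzero line sum, there
  would be at least \<open>k (d - k + 1) \<ge> d\<close> nonzero line sums, a contradiction.

  To compute the line sums, try every set of fewer than \<open>d/2\<close> lines as the set of errors: solve the
  linear system given by the other lines by Gaussian elimination and test whether the result is a
  solution. The true error set passes the test, and by uniqueness whatever passes has the correct
  line sums.
\<close>

section \<open>Line sums over finite sets and their directions\<close>

definition line_total :: "(int \<times> int) set \<Rightarrow> (int \<times> int \<Rightarrow> real) \<Rightarrow> int \<times> int \<Rightarrow> int \<Rightarrow> real" where
  "line_total X g = (\<lambda>(a, b) t. \<Sum>x \<in> {x \<in> X. b * fst x - a * snd x = t}. g x)"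

text \<open>The normalisation keeps one of each pair of opposite vectors, so distinct primitive
  directions are never proportional.\<close>

definition primitive_direction :: "int \<times> int \<Rightarrow> bool" where
  "primitive_direction = (\<lambda>(a, b). coprime a b \<and> a \<ge> 0 \<and> (a = 0 \<longrightarrow> b = 1))"

lemma line_sum_eq_line_total: "line_sum m n a b f h = line_total (grid m n) f (a h, b h)"
  by (rule ext) (auto simp: line_sum_def line_total_def intro!: sum.cong)

lemma finite_grid: "finite (grid m n)"
proof -
  have "grid m n = {0..<int m} \<times> {0..<int n}" by (auto simp: grid_def)
  then show ?thesis by simp
qed

text \<open>The factor \<open>\<phi>\<close> is constant on each line, so the sum can be grouped by
  lines. Any finite \<open>T\<close> containing the support will do, in particular the empty set for
  a direction whose line sums all vanish.\<close>

lemma sum_comp_eq_sum_line_total: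
  assumes "finite X" "finite T" "\<And>t. line_total X g (a, b) t \<noteq> 0 \<Longrightarrow> t \<in> T"
  shows "(\<Sum>x\<in>X. g x * \<phi> (b * fst x - a * snd x)) = (\<Sum>t\<in>T. \<phi> t * line_total X g (a, b) t)"
proof -
  let ?val = "\<lambda>x. b * fst x - a * snd x"
  have "(\<Sum>x\<in>X. g x * \<phi> (?val x)) = (\<Sum>t\<in>?val ` X. \<Sum>x\<in>{x\<in>X. ?val x = t}. g x * \<phi> (?val x))"
    by (rule sum.image_gen) fact
  also have "\<dots> = (\<Sum>t\<in>?val ` X. \<phi> t * line_total X g (a, b) t)"
    by (auto simp: line_total_def sum_distrib_left mult.commute intro!: sum.cong)
  also have "\<dots> = (\<Sum>t\<in>?val ` X \<union> T. \<phi> t * line_total X g (a, b) t)"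
  proof (rule sum.mono_neutral_left)
    show "\<forall>t\<in>?val ` X \<union> T - ?val ` X. \<phi> t * line_total X g (a, b) t = 0"
    proof
      fix t assume "t \<in> ?val ` X \<union> T - ?val ` X"
      then have "{x \<in> X. ?val x = t} = {}" by blast
      then show "\<phi> t * line_total X g (a, b) t = 0"
        unfolding line_total_def prod.case by (simp only: sum.empty mult_zero_right)
    qed
  qed (use assms in auto)
  also have "\<dots> = (\<Sum>t\<in>T. \<phi> t * line_total X g (a, b) t)"
    by (rule sum.mono_neutral_right) (use assms in auto)
  finally show ?thesis .
qed

section \<open>Binary forms and moments\<close>

lemma primitive_direction_slope_inj:
  assumes "primitive_direction (a, b)" "primitive_direction (a', b')" "a \<noteq> 0" "a' \<noteq> 0"
    and "real_of_int b / of_int (- a) = of_int b' / of_int (- a')"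
  shows "(a, b) = (a', b')"
proof -
  have pos: "a > 0" "a' > 0" using assms by (auto simp: primitive_direction_def)
  have "real_of_int (b * a') = of_int (b' * a)"
    using assms(5) pos by (simp add: field_simps)
  then have eq: "b * a' = b' * a" by linarith
  have coprime: "coprime a b" "coprime a' b'" using assms by (auto simp: primitive_direction_def)
  have "a dvd b * a'" "a' dvd b' * a" unfolding eq by (simp, simp flip: eq)
  then have "a dvd a'" "a' dvd a"
    using coprime by (simp_all add: coprime_dvd_mult_right_iff)
  then have "a = a'" using pos by (simp add: zdvd_antisym_nonneg)
  with eq pos show ?thesis by simp
qed

text \<open>Dividing by \<open>of_int (- a) ^ p\<close> turns the directions with
  \<open>a \<noteq> 0\<close> into distinct roots of one univariate polynomial. The direction
  \<open>(0, 1)\<close> is the point at infinity: it removes the top coefficient and so lowers the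
  degree by one. Either way there are too many roots.\<close>

lemma binary_form_vanishes:
  fixes c :: "nat \<Rightarrow> real"
  assumes Z: "finite Z" "p < card Z" "\<And>z. z \<in> Z \<Longrightarrow> primitive_direction z"
    and zero: "\<And>a b. (a, b) \<in> Z \<Longrightarrow> (\<Sum>r\<le>p. c r * of_int b ^ r * of_int (- a) ^ (p - r)) = 0"
    and "r \<le> p"
  shows "c r = 0"
proof (rule ccontr)
  assume "c r \<noteq> 0"
  define slope where "slope = (\<lambda>(a, b). real_of_int b / of_int (- a))"
  define Z' where "Z' = Z - {(0, 1)}"
  have Z'_prim: "primitive_direction z" "fst z \<noteq> 0" if "z \<in> Z'" for z
    using that Z(3)[of z] by (auto simp: Z'_def primitive_direction_def)
  have inj: "inj_on slope Z'"
  proof (rule inj_onI)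
    fix y z assume "y \<in> Z'" "z \<in> Z'" "slope y = slope z"
    then show "y = z"
      using primitive_direction_slope_inj[of "fst y" "snd y" "fst z" "snd z"] Z'_prim[of y] Z'_prim[of z]
      by (auto simp: slope_def split_beta)
  qed
  have root: "(\<Sum>k\<le>p. c k * slope z ^ k) = 0" if z: "z \<in> Z'" for z
  proof -
    obtain a b where ab: "z = (a, b)" by force
    have a: "real_of_int (- a) \<noteq> 0" using Z'_prim[OF z] ab by simp
    have "0 = (\<Sum>k\<le>p. c k * of_int b ^ k * of_int (- a) ^ (p - k)) / of_int (- a) ^ p"
      using zero[of a b] z ab by (simp add: Z'_def)
    also have "\<dots> = (\<Sum>k\<le>p. c k * slope z ^ k)"
      unfolding sum_divide_distrib
    proof (rule sum.cong)
      fix k assume "k \<in> {..p}"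
      then have "real_of_int (- a) ^ p = of_int (- a) ^ (p - k) * of_int (- a) ^ k"
        by (simp flip: power_add)
      then show "c k * of_int b ^ k * of_int (- a) ^ (p - k) / of_int (- a) ^ p = c k * slope z ^ k"
        unfolding ab slope_def prod.case power_divide using a by (simp add: divide_simps)
    qed simp
    finally show ?thesis by simp
  qed
  \<comment> \<open>Used with \<open>q = p\<close>, and with \<open>q = p - 1\<close> once
    \<open>c p\<close> is known to vanish.\<close>
  have bound: "card Z' \<le> q" if "q \<le> p" "\<And>k. k \<le> p \<Longrightarrow> q < k \<Longrightarrow> c k = 0" for q
  proof -
    have "r \<le> q" using that \<open>r \<le> p\<close> \<open>c r \<noteq> 0\<close> not_le by blast
    have "(\<Sum>k\<le>q. c k * x ^ k) = (\<Sum>k\<le>p. c k * x ^ k)" for x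
      by (rule sum.mono_neutral_left) (use that in auto)
    then have "slope ` Z' \<subseteq> {x. (\<Sum>k\<le>q. c k * x ^ k) = 0}" using root by auto
    moreover have "finite {x. (\<Sum>k\<le>q. c k * x ^ k) = 0} \<and> card {x. (\<Sum>k\<le>q. c k * x ^ k) = 0} \<le> q"
      using \<open>r \<le> q\<close> \<open>c r \<noteq> 0\<close> polyfun_rootbound[of c r q] by blast
    ultimately have "card (slope ` Z') \<le> q" by (meson card_mono order_trans)
    then show ?thesis by (simp add: card_image[OF inj])
  qed
  show False
  proof (cases "(0, 1) \<in> Z")
    case True
    \<comment> \<open>Since \<open>0 ^ 0 = 1\<close>, only the term \<open>k = p\<close> survives at
      this direction.\<close>
    have "(\<Sum>k\<le>p. c k * of_int 1 ^ k * of_int (- 0) ^ (p - k)) = (\<Sum>k\<le>p. if k = p then c k else 0)"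
      by (rule sum.cong) (auto simp: power_0_left)
    with zero[OF True] have "c p = 0" by simp
    then have "p \<noteq> 0" using \<open>c r \<noteq> 0\<close> \<open>r \<le> p\<close> by (cases p) auto
    have "card Z' \<le> p - 1"
    proof (rule bound)
      fix k assume "k \<le> p" "p - 1 < k"
      then have "k = p" by linarith
      then show "c k = 0" using \<open>c p = 0\<close> by simp
    qed simp
    then show False using Z \<open>p \<noteq> 0\<close> True by (simp add: Z'_def)
  next
    case False
    have "card Z' \<le> p" by (rule bound) auto
    then show False using Z False by (simp add: Z'_def)
  qed
qed

text \<open>At \<open>(u, v) = (b, - a)\<close> with \<open>(a, b)\<close> in \<open>Z\<close> the
  sum is the \<open>p\<close>-th moment of line sums that all vanish;
  \<open>binary_form_vanishes\<close> then kills every coefficient of the form.\<close>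

lemma moment_eq_0:
  assumes X: "finite X" and Z: "finite Z" "p < card Z" "\<And>z. z \<in> Z \<Longrightarrow> primitive_direction z"
    and zero: "\<And>z t. z \<in> Z \<Longrightarrow> line_total X g z t = 0"
  shows "(\<Sum>x\<in>X. g x * (u * of_int (fst x) + v * of_int (snd x)) ^ p) = 0"
proof -
  define c where "c r = of_nat (p choose r) * (\<Sum>x\<in>X. g x * of_int (fst x) ^ r * of_int (snd x) ^ (p - r))" for r
  have expand: "(\<Sum>x\<in>X. g x * (u * of_int (fst x) + v * of_int (snd x)) ^ p) = (\<Sum>r\<le>p. c r * u ^ r * v ^ (p - r))" for u v
  proof -
    have "(\<Sum>x\<in>X. g x * (u * of_int (fst x) + v * of_int (snd x)) ^ p) =
      (\<Sum>x\<in>X. \<Sum>r\<le>p. of_nat (p choose r) * (g x * of_int (fst x) ^ r * of_int (snd x) ^ (p - r)) * u ^ r * v ^ (p - r))"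
      by (simp add: binomial_ring sum_distrib_left power_mult_distrib algebra_simps)
    also have "\<dots> = (\<Sum>r\<le>p. c r * u ^ r * v ^ (p - r))"
      by (subst sum.swap) (simp add: c_def sum_distrib_left sum_distrib_right)
    finally show ?thesis .
  qed
  have "c r = 0" if "r \<le> p" for r
  proof (rule binary_form_vanishes[OF Z _ that])
    fix a b assume ab: "(a, b) \<in> Z"
    have "(\<Sum>x\<in>X. g x * (\<lambda>t. of_int t ^ p) (b * fst x - a * snd x)) = (\<Sum>t\<in>{}. of_int t ^ p * line_total X g (a, b) t)"
      by (rule sum_comp_eq_sum_line_total) (use X zero[OF ab] in auto)
    then show "(\<Sum>r\<le>p. c r * of_int b ^ r * of_int (- a) ^ (p - r)) = 0"
      using expand[of "of_int b" "of_int (- a)"] by simp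
  qed auto
  then show ?thesis by (simp add: expand)
qed

section \<open>Counting nonzero line sums\<close>

text \<open>If the support had at most \<open>card Z\<close> points, some polynomial of degree less
  than \<open>card Z\<close> would vanish at all of them except \<open>t\<^sub>0\<close>.
  Orthogonality to it would leave a single nonzero term.\<close>

lemma card_support_line_total:
  assumes X: "finite X" and Z: "finite Z" "\<And>z. z \<in> Z \<Longrightarrow> primitive_direction z"
    and zero: "\<And>z t. z \<in> Z \<Longrightarrow> line_total X g z t = 0"
    and nz: "line_total X g (a, b) t\<^sub>0 \<noteq> 0" and fin: "finite {t. line_total X g (a, b) t \<noteq> 0}"
  shows "card Z < card {t. line_total X g (a, b) t \<noteq> 0}"
proof (rule ccontr)
  define T where "T = {t. line_total X g (a, b) t \<noteq> 0}"
  assume "\<not> card Z < card {t. line_total X g (a, b) t \<noteq> 0}"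
  then have le: "card T \<le> card Z" by (simp add: T_def)
  have T: "finite T" "t\<^sub>0 \<in> T" using nz fin by (auto simp: T_def)
  define q where "q = (\<Prod>s\<in>T - {t\<^sub>0}. [:- real_of_int s, 1:])"
  have "degree q = (\<Sum>s\<in>T - {t\<^sub>0}. degree [:- real_of_int s, 1:])"
    unfolding q_def by (rule degree_prod_sum_eq) simp
  also have "\<dots> = card T - 1" using T by simp
  finally have deg: "degree q < card Z" using le T card_gt_0_iff[of T] by fastforce
  have q_eval: "poly q (of_int t) = (\<Prod>s\<in>T - {t\<^sub>0}. of_int t - of_int s)" for t
    by (simp add: q_def poly_prod)
  have "(\<Sum>x\<in>X. g x * poly q (of_int (b * fst x - a * snd x))) =
      (\<Sum>k\<le>degree q. coeff q k * (\<Sum>x\<in>X. g x * (of_int b * of_int (fst x) + of_int (- a) * of_int (snd x)) ^ k))"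
    by (simp add: poly_altdef sum_distrib_left algebra_simps) (subst sum.swap, simp)
  also have "\<dots> = 0"
    by (intro sum.neutral ballI, subst moment_eq_0[OF X Z(1) _ Z(2) zero]) (use deg in auto)
  finally have "0 = (\<Sum>t\<in>T. poly q (of_int t) * line_total X g (a, b) t)"
    using sum_comp_eq_sum_line_total[OF X T(1), of g a b "\<lambda>t. poly q (of_int t)"] by (simp add: T_def)
  also have "\<dots> = poly q (of_int t\<^sub>0) * line_total X g (a, b) t\<^sub>0"
    using T by (subst sum.remove[of _ t\<^sub>0]) (auto simp: q_eval intro!: sum.neutral)
  finally have "poly q (of_int t\<^sub>0) = 0" using nz by simp
  then show False using T by (auto simp: q_eval)
qed

lemma line_totals_vanish:
  assumes X: "finite X" and D: "finite D" "\<And>z. z \<in> D \<Longrightarrow> primitive_direction z"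
    and fin: "finite {(z, t). z \<in> D \<and> line_total X g z t \<noteq> 0}"
    and few: "card {(z, t). z \<in> D \<and> line_total X g z t \<noteq> 0} < card D"
    and "z \<in> D"
  shows "line_total X g z t = 0"
proof (rule ccontr)
  assume nz: "line_total X g z t \<noteq> 0"
  define supp where "supp z = {t. line_total X g z t \<noteq> 0}" for z
  define Z where "Z = {z \<in> D. supp z = {}}"
  define K where "K = D - Z"
  have W: "{(z, t). z \<in> D \<and> line_total X g z t \<noteq> 0} = Sigma D supp"
    by (auto simp: supp_def)
  have fin_supp: "finite (supp z)" if "z \<in> D" for z
  proof -
    have "supp z \<subseteq> snd ` Sigma D supp" using that by force
    then show ?thesis using fin W finite_subset by (metis finite_imageI)
  qed
  have "z \<in> K" using nz \<open>z \<in> D\<close> by (auto simp: K_def Z_def supp_def)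
  have K: "finite K" "K \<subseteq> D" "card K = card D - card Z" "card Z \<le> card D"
    using D by (auto simp: K_def Z_def card_Diff_subset card_mono)
  have "card K > 0" using \<open>z \<in> K\<close> K card_gt_0_iff by blast
  have "card Z < card (supp y)" if y: "y \<in> K" for y
  proof -
    obtain a b where [simp]: "y = (a, b)" by force
    obtain s where "s \<in> supp y" using y by (auto simp: K_def Z_def)
    then have nz: "line_total X g (a, b) s \<noteq> 0" by (simp add: supp_def)
    have fin: "finite {t. line_total X g (a, b) t \<noteq> 0}"
      using fin_supp[of y] y K by (auto simp: supp_def)
    have "card Z < card {t. line_total X g (a, b) t \<noteq> 0}"
      by (rule card_support_line_total[OF X _ _ _ nz fin]) (use D in \<open>auto simp: Z_def supp_def\<close>)
    then show ?thesis by (simp add: supp_def)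
  qed
  then have "card K * (card Z + 1) \<le> (\<Sum>y\<in>K. card (supp y))"
    using sum_bounded_below[of K "card Z + 1" "\<lambda>y. card (supp y)"] by (simp add: Suc_le_eq)
  also have "\<dots> \<le> (\<Sum>y\<in>D. card (supp y))"
    by (rule sum_mono2) (use D K in auto)
  also have "\<dots> = card (Sigma D supp)"
    by (rule card_SigmaI[symmetric]) (use D fin_supp in auto)
  finally have "card K * (card Z + 1) < card D" using few W by simp
  \<comment> \<open>With \<open>k = card K\<close> and \<open>z = card Z\<close> the bound reads
    \<open>k * (z + 1) < k + z\<close>, impossible for \<open>k \<ge> 1\<close> because the left
    side exceeds the right by \<open>(k - 1) * z\<close>.\<close>
  moreover have "card D = card K + card Z" using K by simp
  moreover obtain k where "card K = Suc k" using \<open>card K > 0\<close> gr0_implies_Suc by blast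
  ultimately show False by simp
qed


section \<open>Uniqueness of the line sums\<close>

text \<open>Two grids are allowed so that the recovered values will not depend on the grid size.
  Both functions are extended by zero to the union of the grids; the nonzero line sums of their
  difference are indexed by pairs in \<open>E\<close>.\<close>

lemma line_sums_unique:
  fixes a b :: "nat \<Rightarrow> int"
  assumes inj: "inj_on (\<lambda>h. (a h, b h)) {1..d}"
    and prim: "\<And>h. h \<in> {1..d} \<Longrightarrow> primitive_direction (a h, b h)"
    and E: "finite E" "card E < d"
    and differ: "\<And>h t. h \<in> {1..d} \<Longrightarrow> line_sum m n a b f h t \<noteq> line_sum m' n' a b f' h t \<Longrightarrow> (h, t) \<in> E"
    and "h \<in> {1..d}"
  shows "line_sum m n a b f h t = line_sum m' n' a b f' h t"
proof -
  define X where "X = grid m n \<union> grid m' n'"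
  define g where "g x = (if x \<in> grid m n then f x else 0) - (if x \<in> grid m' n' then f' x else 0)" for x
  define D where "D = (\<lambda>h. (a h, b h)) ` {1..d}"
  have X: "finite X" by (simp add: X_def finite_grid)
  have g: "line_total X g (a h, b h) t = line_sum m n a b f h t - line_sum m' n' a b f' h t" for h t
  proof -
    have "(\<Sum>x\<in>{x \<in> X. P x}. if x \<in> Y then k x else 0) = (\<Sum>x\<in>{x \<in> Y. P x}. k x)"
      if "Y \<subseteq> X" for P Y and k :: "int \<times> int \<Rightarrow> real"
      by (rule sum.mono_neutral_cong_right) (use X that in auto)
    then show ?thesis
      by (simp add: line_sum_eq_line_total line_total_def g_def sum_subtractf X_def)
  qed
  define V where "V = {(z, t). z \<in> D \<and> line_total X g z t \<noteq> 0}"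
  have sub: "V \<subseteq> (\<lambda>(h, t). ((a h, b h), t)) ` E"
  proof
    fix v assume "v \<in> V"
    then obtain h t where "v = ((a h, b h), t)" "h \<in> {1..d}"
      "line_sum m n a b f h t \<noteq> line_sum m' n' a b f' h t"
      by (auto simp: V_def D_def g)
    with differ show "v \<in> (\<lambda>(h, t). ((a h, b h), t)) ` E" by force
  qed
  have card_D: "card D = d" unfolding D_def card_image[OF inj] by simp
  have "card V \<le> card E"
    using surj_card_le[OF E(1) sub] .
  then have "card V < card D" using E card_D by simp
  then have "line_total X g (a h, b h) t = 0"
    using finite_subset[OF sub] E prim \<open>h \<in> {1..d}\<close> unfolding V_def
    by (intro line_totals_vanish[OF X, of D]) (auto simp: D_def)
  then show ?thesis by (simp add: g)
qed

section \<open>Functions computed by programs\<close>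

text \<open>One program serves all inputs \<open>l\<close>. The closure rules below then yield
  programs without writing them out.\<close>

definition computable :: "((nat \<Rightarrow> int \<Rightarrow> real) \<Rightarrow> real) \<Rightarrow> bool" where
  "computable F \<longleftrightarrow> (\<exists>p. \<forall>l. run p l = F l)"

lemma computable_measured: "computable (\<lambda>l. l h t)"
  unfolding computable_def by (rule exI[of _ "Measured h t"]) simp

lemma computable_const: "c \<in> \<rat> \<Longrightarrow> computable (\<lambda>l. c)"
  unfolding computable_def by (elim Rats_cases) (metis run.simps(2))

lemma computable_add: "computable F \<Longrightarrow> computable G \<Longrightarrow> computable (\<lambda>l. F l + G l)"
  unfolding computable_def by (metis run.simps(3))

lemma computable_diff: "computable F \<Longrightarrow> computable G \<Longrightarrow> computable (\<lambda>l. F l - G l)"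
  unfolding computable_def by (metis run.simps(4))

lemma computable_mult: "computable F \<Longrightarrow> computable G \<Longrightarrow> computable (\<lambda>l. F l * G l)"
  unfolding computable_def by (metis run.simps(5))

lemma computable_if_nonpos:
  "computable C \<Longrightarrow> computable F \<Longrightarrow> computable G \<Longrightarrow> computable (\<lambda>l. if C l \<le> 0 then F l else G l)"
  unfolding computable_def by (metis run.simps(7))

lemma computable_sum:
  "(\<And>x. x \<in> A \<Longrightarrow> computable (F x)) \<Longrightarrow> computable (\<lambda>l. \<Sum>x\<in>A. F x l)"
  by (induction A rule: infinite_finite_induct) (auto intro: computable_const computable_add)

lemmas computable_intros = computable_measured computable_const computable_add computable_diff
  computable_mult computable_if_nonpos computable_sum

text \<open>Gaussian elimination needs no branching on the data, since the coefficients are fixed.\<close>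

lemma computable_linear_solution:
  fixes R :: "'i \<Rightarrow> 'x \<Rightarrow> real"
  assumes "finite X" "\<And>i x. R i x \<in> \<rat>" "\<And>i. computable (Y i)"
  shows "\<exists>G. (\<forall>x. computable (G x)) \<and>
    (\<forall>l f. (\<forall>i\<in>J. (\<Sum>x\<in>X. R i x * f x) = Y i l) \<longrightarrow> (\<forall>i\<in>J. (\<Sum>x\<in>X. R i x * G x l) = Y i l))"
  using assms
proof (induction X arbitrary: R Y rule: finite_induct)
  case empty
  then show ?case by (intro exI[of _ "\<lambda>_ _. 0"]) (auto intro: computable_const)
next
  case (insert x\<^sub>0 X)
  show ?case
  proof (cases "\<forall>i\<in>J. R i x\<^sub>0 = 0")
    case True
    then show ?thesis using insert.IH[OF insert.prems] insert.hyps by simp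
  next
    case False
    then obtain i\<^sub>0 where i\<^sub>0: "i\<^sub>0 \<in> J" "R i\<^sub>0 x\<^sub>0 \<noteq> 0" by blast
    \<comment> \<open>The pivot row \<open>i\<^sub>0\<close> depends on the coefficients only, never
      on the data. Subtracting \<open>q i\<close> times it clears \<open>x\<^sub>0\<close> from row
      \<open>i\<close>; the pivot row itself becomes \<open>0 = 0\<close>.\<close>
    define q where "q i = R i x\<^sub>0 / R i\<^sub>0 x\<^sub>0" for i
    have q: "q i \<in> \<rat>" "q i * R i\<^sub>0 x\<^sub>0 = R i x\<^sub>0" for i using insert.prems i\<^sub>0 by (auto simp: q_def)
    have elim: "(\<Sum>x\<in>X. (R i x - q i * R i\<^sub>0 x) * f x) = (\<Sum>x\<in>X. R i x * f x) - q i * (\<Sum>x\<in>X. R i\<^sub>0 x * f x)" for i f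
      by (simp add: left_diff_distrib sum_subtractf sum_distrib_left mult.assoc)
    define solves where "solves f l \<longleftrightarrow>
      (\<forall>i\<in>J. (\<Sum>x\<in>X. (R i x - q i * R i\<^sub>0 x) * f x) = Y i l - q i * Y i\<^sub>0 l)" for f l
    have "\<exists>G. (\<forall>x. computable (G x)) \<and> (\<forall>l f. solves f l \<longrightarrow> solves (\<lambda>x. G x l) l)"
      unfolding solves_def
      by (rule insert.IH) (use insert.prems q(1) in \<open>auto intro!: computable_intros\<close>)
    then obtain G where G: "\<And>x. computable (G x)"
      and sol: "\<And>l f. solves f l \<Longrightarrow> solves (\<lambda>x. G x l) l" by blast
    \<comment> \<open>Back substitution into the pivot equation; dividing by the pivot is
      multiplication by a rational constant.\<close>
    define G' where "G' x l = (if x = x\<^sub>0 then inverse (R i\<^sub>0 x\<^sub>0) * (Y i\<^sub>0 l - (\<Sum>x\<in>X. R i\<^sub>0 x * G x l)) else G x l)" for x l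
    have "computable (G' x)" for x
      using G insert.prems by (cases "x = x\<^sub>0") (auto simp: G'_def[abs_def] intro!: computable_intros)
    moreover have "(\<Sum>x\<in>insert x\<^sub>0 X. R i x * G' x l) = Y i l"
      if f: "\<And>i. i \<in> J \<Longrightarrow> (\<Sum>x\<in>insert x\<^sub>0 X. R i x * f x) = Y i l" and i: "i \<in> J" for l f i
    proof -
      have "(\<Sum>x\<in>X. (R i x - q i * R i\<^sub>0 x) * f x) = Y i l - q i * Y i\<^sub>0 l" if "i \<in> J" for i
        unfolding elim f[OF that, symmetric] f[OF i\<^sub>0(1), symmetric] sum.insert[OF insert.hyps]
          q(2)[of i, symmetric] by (simp add: algebra_simps)
      then have "(\<Sum>x\<in>X. (R i x - q i * R i\<^sub>0 x) * G x l) = Y i l - q i * Y i\<^sub>0 l"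
        using sol i unfolding solves_def by blast
      moreover have "(\<Sum>x\<in>X. R i x * G' x l) = (\<Sum>x\<in>X. R i x * G x l)"
        by (rule sum.cong) (use insert.hyps in \<open>auto simp: G'_def\<close>)
      moreover have "R i x\<^sub>0 * G' x\<^sub>0 l = q i * (Y i\<^sub>0 l - (\<Sum>x\<in>X. R i\<^sub>0 x * G x l))"
        using i\<^sub>0 by (simp add: G'_def q_def divide_inverse)
      ultimately show ?thesis
        unfolding elim sum.insert[OF insert.hyps] by (simp add: right_diff_distrib)
    qed
    ultimately show ?thesis by (intro exI[of _ G']) blast
  qed
qed

text \<open>Nested conditionals return the output of some candidate that passes, which suffices when
  all passing candidates have the same output.\<close>

lemma computable_search:
  assumes "finite A" "\<And>S. computable (test S)" "\<And>S. computable (out S)"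
  shows "\<exists>F. computable F \<and>
    (\<forall>l. (\<exists>S\<in>A. test S l \<le> 0) \<longrightarrow> (\<exists>S\<in>A. test S l \<le> 0 \<and> F l = out S l))"
  using assms(1)
proof (induction A rule: finite_induct)
  case empty
  \<comment> \<open>With no candidates the condition is vacuous, so any measured value serves as
    default.\<close>
  show ?case using computable_measured by blast
next
  case (insert S A)
  then obtain F where F: "computable F"
    "\<And>l. \<exists>S\<in>A. test S l \<le> 0 \<Longrightarrow> \<exists>S\<in>A. test S l \<le> 0 \<and> F l = out S l" by blast
  then have "computable (\<lambda>l. if test S l \<le> 0 then out S l else F l)"
    using assms by (intro computable_intros)
  with F(2) show ?case by (intro exI[of _ "\<lambda>l. if test S l \<le> 0 then out S l else F l"]) auto
qed

section \<open>Search for the set of errors\<close>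

text \<open>A passing candidate \<open>S\<close> need not be the true error set, nor its solution
  equal to \<open>f\<close>. Both sets have fewer than \<open>d/2\<close> elements, so the two
  functions differ in fewer than \<open>d\<close> line sums and uniqueness applies.\<close>

lemma line_sums_computable:
  fixes a b :: "nat \<Rightarrow> int"
  assumes inj: "inj_on (\<lambda>h. (a h, b h)) {1..d}"
    and prim: "\<And>h. h \<in> {1..d} \<Longrightarrow> primitive_direction (a h, b h)"
    and h: "h \<in> {1..d}"
  shows "\<exists>F. computable F \<and> (\<forall>f l. finite (wrong_line_sums d (line_sum m n a b f) l) \<and>
    2 * card (wrong_line_sums d (line_sum m n a b f) l) < d \<longrightarrow> F l = line_sum m n a b f h t)"
proof -
  \<comment> \<open>A finite set containing every line that meets the grid; off it all line sums are
    zero.\<close>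
  define I where "I = {1..d} \<times> (\<Union>h\<in>{1..d}. (\<lambda>x. b h * fst x - a h * snd x) ` grid m n)"
  define R where "R = (\<lambda>(h, t) x. if b h * fst x - a h * snd x = t then 1 else 0 :: real)"
  have fin_I: "finite I" by (auto simp: I_def finite_grid)
  have R: "line_sum m n a b f h t = (\<Sum>x\<in>grid m n. R (h, t) x * f x)" for f h t
    unfolding line_sum_eq_line_total line_total_def R_def prod.case
    by (rule sum.mono_neutral_cong_left) (auto simp: finite_grid)
  have outside: "line_sum m n a b f h t = 0" if "h \<in> {1..d}" "(h, t) \<notin> I" for f h t
    unfolding R by (rule sum.neutral) (use that in \<open>auto simp: R_def I_def\<close>)
  define solves where "solves S f l \<longleftrightarrow> (\<forall>i\<in>I - S. (\<Sum>x\<in>grid m n. R i x * f x) = l (fst i) (snd i))" for S f l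
  have "\<exists>G. (\<forall>x. computable (G x)) \<and> (\<forall>l f. solves S f l \<longrightarrow> solves S (\<lambda>x. G x l) l)" for S
    unfolding solves_def by (rule computable_linear_solution)
      (auto simp: finite_grid R_def split_beta intro: computable_measured)
  then obtain G where G: "\<And>S x. computable (G S x)"
    and sol: "\<And>S l f. solves S f l \<Longrightarrow> solves S (\<lambda>x. G S x l) l"
    by metis
  have solves_iff: "solves S f l \<longleftrightarrow> (\<forall>h t. (h, t) \<in> I - S \<longrightarrow> line_sum m n a b f h t = l h t)" for S f l
    by (auto simp: solves_def R)
  have ls: "computable (\<lambda>l. line_sum m n a b (\<lambda>x. G S x l) h t)" for S h t
    unfolding R by (intro computable_intros G) (simp add: R_def)
  \<comment> \<open>A sum of squares, so that one sign test decides all equations outside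
    \<open>S\<close>.\<close>
  define test where "test S l = (\<Sum>i\<in>I - S. (line_sum m n a b (\<lambda>x. G S x l) (fst i) (snd i) - l (fst i) (snd i))
      * (line_sum m n a b (\<lambda>x. G S x l) (fst i) (snd i) - l (fst i) (snd i)))" for S l
  have test: "computable (test S)" for S
    unfolding test_def[abs_def] by (intro computable_intros ls)
  have test_iff: "test S l \<le> 0 \<longleftrightarrow> solves S (\<lambda>x. G S x l) l" for S l
  proof -
    have "test S l \<ge> 0" unfolding test_def by (intro sum_nonneg) simp
    then have "test S l \<le> 0 \<longleftrightarrow> test S l = 0" by linarith
    also have "\<dots> \<longleftrightarrow> (\<forall>i\<in>I - S. line_sum m n a b (\<lambda>x. G S x l) (fst i) (snd i) = l (fst i) (snd i))"
      unfolding test_def by (subst sum_nonneg_eq_0_iff) (use fin_I in auto)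
    finally show ?thesis by (simp add: solves_def R)
  qed
  define A where "A = {S. S \<subseteq> I \<and> 2 * card S < d}"
  have "finite A" by (rule finite_subset[of _ "Pow I"]) (auto simp: A_def fin_I)
  from computable_search[of A test "\<lambda>S l. line_sum m n a b (\<lambda>x. G S x l) h t", OF this test ls]
  obtain F where F: "computable F"
    "\<And>l. \<exists>S\<in>A. test S l \<le> 0 \<Longrightarrow> \<exists>S\<in>A. test S l \<le> 0 \<and> F l = line_sum m n a b (\<lambda>x. G S x l) h t"
    by blast
  have "F l = line_sum m n a b f h t"
    if W: "finite (wrong_line_sums d (line_sum m n a b f) l)"
      "2 * card (wrong_line_sums d (line_sum m n a b f) l) < d" for f l
  proof -
    \<comment> \<open>Wrong values outside \<open>I\<close> do not enter the equations.\<close>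
    define S\<^sub>0 where "S\<^sub>0 = I \<inter> wrong_line_sums d (line_sum m n a b f) l"
    have "card S\<^sub>0 \<le> card (wrong_line_sums d (line_sum m n a b f) l)"
      unfolding S\<^sub>0_def by (rule card_mono) (use W in auto)
    then have S\<^sub>0: "S\<^sub>0 \<in> A" using W by (auto simp: A_def S\<^sub>0_def)
    have correct: "line_sum m n a b f h t = l h t" if "(h, t) \<in> I - S\<^sub>0" for h t
      using that by (auto simp: S\<^sub>0_def wrong_line_sums_def I_def)
    \<comment> \<open>\<open>f\<close> solves the equations outside \<open>S\<^sub>0\<close>, so
      elimination also finds a solution of them.\<close>
    have "test S\<^sub>0 l \<le> 0" unfolding test_iff using sol[of S\<^sub>0 f l] correct by (simp add: solves_iff)
    then obtain S where S: "S \<in> A" "test S l \<le> 0" "F l = line_sum m n a b (\<lambda>x. G S x l) h t"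
      using F(2) S\<^sub>0 by blast
    have "line_sum m n a b (\<lambda>x. G S x l) h t = line_sum m n a b f h t"
    proof (rule line_sums_unique[OF inj prim _ _ _ h])
      show "finite (S \<union> S\<^sub>0)" using S S\<^sub>0 fin_I by (auto simp: A_def intro: finite_subset)
      show "card (S \<union> S\<^sub>0) < d" using S S\<^sub>0 card_Un_le[of S S\<^sub>0] by (auto simp: A_def)
      \<comment> \<open>Outside \<open>I\<close> both sums are zero; inside \<open>I\<close> but off
        both sets, both equal the measured value.\<close>
      show "(h, t) \<in> S \<union> S\<^sub>0"
        if "h \<in> {1..d}" "line_sum m n a b (\<lambda>x. G S x l) h t \<noteq> line_sum m n a b f h t" for h t
        using that outside[of h t] S(2)[unfolded test_iff solves_iff] correct[of h t] by (metis Diff_iff UnCI)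
    qed
    with S show ?thesis by simp
  qed
  with F(1) show ?thesis by blast
qed

text \<open>\<open>determine\<close> is chosen before \<open>m\<close> and \<open>n\<close>, so it
  depends only on the directions and the data; the programs are built for one grid size, which fixes
  the lines they use. Finiteness is stated because an infinite set has \<open>card\<close>
  zero.\<close>

theorem theorem2p1:
  fixes d :: nat and a b :: "nat \<Rightarrow> int"
  assumes "d > 0"
    and "inj_on (\<lambda>h. (a h, b h)) {1..d}"
    and "\<And>h. h \<in> {1..d} \<Longrightarrow> coprime (a h) (b h)"
    and "\<And>h. h \<in> {1..d} \<Longrightarrow> a h \<ge> 0"
    and "\<And>h. h \<in> {1..d} \<Longrightarrow> a h = 0 \<Longrightarrow> b h = 1"
  shows "\<exists>determine :: (nat \<Rightarrow> int \<Rightarrow> real) \<Rightarrow> nat \<Rightarrow> int \<Rightarrow> real.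
    \<forall>m > 0. \<forall>n > 0. \<exists>program :: nat \<Rightarrow> int \<Rightarrow> real_program.
      \<forall>(f :: int \<times> int \<Rightarrow> real) (lstar :: nat \<Rightarrow> int \<Rightarrow> real).
        finite (wrong_line_sums d (line_sum m n a b f) lstar) \<and>
        real (card (wrong_line_sums d (line_sum m n a b f) lstar)) < real d / 2 \<longrightarrow>
        (\<forall>h \<in> {1..d}. \<forall>t.
          determine lstar h t = line_sum m n a b f h t \<and>
          run (program h t) lstar = line_sum m n a b f h t)"
proof -
  have prim: "primitive_direction (a h, b h)" if "h \<in> {1..d}" for h
    using assms(3-5)[OF that] by (simp add: primitive_direction_def)
  define few where "few m n f lstar \<longleftrightarrow> finite (wrong_line_sums d (line_sum m n a b f) lstar) \<and>
    2 * card (wrong_line_sums d (line_sum m n a b f) lstar) < d" for m n f lstar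
  have few_iff: "finite (wrong_line_sums d (line_sum m n a b f) lstar) \<and>
    real (card (wrong_line_sums d (line_sum m n a b f) lstar)) < real d / 2 \<longleftrightarrow> few m n f lstar" for m n f lstar
    by (auto simp: few_def)
  \<comment> \<open>Each candidate disagrees with \<open>lstar\<close> in fewer than
    \<open>d/2\<close> places, so the two disagree with each other in fewer than
    \<open>d\<close>.\<close>
  have unique: "line_sum m n a b f h t = line_sum m' n' a b f' h t"
    if "few m n f lstar" "few m' n' f' lstar" "h \<in> {1..d}" for m n f m' n' f' lstar h t
  proof (rule line_sums_unique[OF assms(2) prim _ _ _ that(3)])
    let ?W = "wrong_line_sums d (line_sum m n a b f) lstar"
    let ?W' = "wrong_line_sums d (line_sum m' n' a b f') lstar"
    show "finite (?W \<union> ?W')" using that by (simp add: few_def)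
    show "card (?W \<union> ?W') < d" using that card_Un_le[of ?W ?W'] by (simp add: few_def)
  qed (auto simp: wrong_line_sums_def)
  \<comment> \<open>By \<open>unique\<close>, all admissible explanations of \<open>lstar\<close>,
    on grids of any size, give one value for \<open>h\<close> in \<open>{1..d}\<close>; without an
    explanation the choice is arbitrary.\<close>
  define determine where "determine lstar h t =
    (SOME y. \<exists>m n f. few m n f lstar \<and> y = line_sum m n a b f h t)" for lstar h t
  have determine: "determine lstar h t = line_sum m n a b f h t"
    if few: "few m n f lstar" and h: "h \<in> {1..d}" for m n f lstar h t
    unfolding determine_def
  proof (rule some1_equality)
    show "\<exists>!y. \<exists>m n f. few m n f lstar \<and> y = line_sum m n a b f h t"
      using few unique[OF _ _ h] by blast
  qed (use few in blast)
  have "\<exists>p. \<forall>h\<in>{1..d}. \<forall>t f lstar. few m n f lstar \<longrightarrow> run (p h t) lstar = line_sum m n a b f h t" for m n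
  proof -
    have "\<exists>p. \<forall>f lstar. few m n f lstar \<longrightarrow> run p lstar = line_sum m n a b f h t" if "h \<in> {1..d}" for h t
      using line_sums_computable[OF assms(2) prim that, of m n t] unfolding few_def computable_def by metis
    then show ?thesis by metis
  qed
  then show ?thesis unfolding few_iff using determine by (intro exI[of _ determine]) metis
qed

end
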